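(* Let $p_2\ne0$, $p_4>0$, $\rho>0$, and consider the system $$\mathcal{D}'=2p_2\mathcal{I}\mathcal{R},\qquad\mathcal{R}'=-2p_2\mathcal{I}\mathcal{D}-2p_4\rho\,\mathcal{I},\qquad\mathcal{I}'=2p_4\rho\,\mathcal{R}$$ on $S^2_\rho$. The two points $\pm(\rho,0,0)$ are fixed points. Further, if $|p_2|\ge p_4$ then the points $\big(-\frac{p_4}{p_2}\rho,0,\pm\sqrt{1-(\frac{p_4}{p_2})^2}\,\rho\big)$ are also fixed points. In the other case, the triplet $$(f,g,h):=\big(4p_2p_4\rho\,\mathcal{R},\ 4p_4\rho(p_2\mathcal{D}+p_4\rho),\ -2p_2\mathcal{I}\big)$$ solves $$f'=gh,\qquad g'=-fh,\qquad h'=-f,$$ and hence $(\mathcal{D},\mathcal{R},\mathcal{I})$ is given explicitly through the following formulas, where $(f_0,g_0,h_0)$ is the value of $(f,g,h)$ at time $0$. If $(f_0,h_0)=(0,0)$ then $(f,g,h)(t)=(0,g_0,0)$. If $(f_0,g_0)=(0,0)$ then $(f,g,h)(t)=(0,0,h_0)$. Otherwise $$f(t)=-h'(t),\qquad g(t)=\tfrac12(h(t)^2-h_0^2)+g_0,$$ and $h(t)$ is as follows, where $P,R_{fg}>0$ are given by $P^2=\frac{(f_0^2+g_0^2)^{1/2}-g_0}{2}+\frac{h_0^2}{4}$ and $R_{fg}^2=(f_0^2+g_0^2)^{1/2}$: (i) if $h_0^2<2(\sqrt{f_0^2+g_0^2}+g_0)$, then $h(t)=2P\operatorname{cn}\big(R_{fg}t+t_0,\frac{P^2}{R_{fg}^2}\big)$,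 where $t_0$ is given by $\operatorname{cn}(t_0,P^2/R_{fg}^2)=h_0/(2P)$ and $\operatorname{sign}(\operatorname{sn}(t_0,P^2/R_{fg}^2))=\operatorname{sign}f_0$; (ii) if $h_0^2=2(\sqrt{f_0^2+g_0^2}+g_0)$, then $h_0\ne0$ and $h(t)=(\operatorname{sign}h_0)2P\operatorname{sech}(Pt+t_0)$, where $t_0=\operatorname{sign}(f_0h_0)\cosh^{-1}(2P/|h_0|)$; (iii) if $h_0^2>2(\sqrt{f_0^2+g_0^2}+g_0)$, then $h(t)=(\operatorname{sign}h_0)2P\operatorname{dn}\big((\operatorname{sign}h_0)Pt+t_0,\frac{R_{fg}^2}{P^2}\big)$, where $t_0$ is given by $\operatorname{dn}(t_0,R_{fg}^2/P^2)=|h_0|/(2P)$ and $\operatorname{sign}\operatorname{dn}'(t_0)=-\operatorname{sign}f_0$.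
   Context: $S^2_\rho=\{(x,y,z)\in\mathbb{R}^3: x^2+y^2+z^2=\rho^2\}$; the unknown $(\mathcal{D},\mathcal{R},\mathcal{I})$ is real valued with initial data in $S_\rho^2$, and the system preserves $S^2_\rho$. "In the other case" means for initial data other than the listed fixed points. $\operatorname{dn}'$ is the derivative of $\operatorname{dn}(u,m)$ in $u$; $\operatorname{sign}0=0$. Jacobi elliptic functions with parameter $m\in[0,1)$: for $u\in\mathbb{R}$ define $\phi$ by $u=\int_0^\phi\frac{d\theta}{\sqrt{1-m\sin^2\theta}}$; then $\operatorname{sn}(u,m)=\sin\phi$, $\operatorname{cn}(u,m)=\cos\phi$, $\operatorname{dn}(u,m)=\sqrt{1-m\sin^2\phi}$. *)

theory Defs
  imports "HOL-Analysis.Analysis"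
begin

definition sphere2 :: "real \<Rightarrow> (real \<times> real \<times> real) set" where
  "sphere2 \<rho> = {(x, y, z). x^2 + y^2 + z^2 = \<rho>^2}"

definition vfield :: "real \<Rightarrow> real \<Rightarrow> real \<Rightarrow> real \<times> real \<times> real \<Rightarrow> real \<times> real \<times> real" where
  "vfield p2 p4 \<rho> = (\<lambda>(D, R, I).
     (2 * p2 * I * R, - 2 * p2 * I * D - 2 * p4 * \<rho> * I, 2 * p4 * \<rho> * R))"

definition fixed_point :: "real \<Rightarrow> real \<Rightarrow> real \<Rightarrow> real \<times> real \<times> real \<Rightarrow> bool" where
  "fixed_point p2 p4 \<rho> x \<longleftrightarrow> x \<in> sphere2 \<rho> \<and> vfield p2 p4 \<rho> x = (0, 0, 0)"

definition axis_points :: "real \<Rightarrow> (real \<times> real \<times> real) set" where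
  "axis_points \<rho> = {(\<rho>, 0, 0), (- \<rho>, 0, 0)}"

text \<open>Meaningful only for \<open>\<bar>p2\<bar> \<ge> p4 > 0\<close>: otherwise the argument of the square root is negative.\<close>
definition side_points :: "real \<Rightarrow> real \<Rightarrow> real \<Rightarrow> (real \<times> real \<times> real) set" where
  "side_points p2 p4 \<rho> =
     {(- (p4 / p2) * \<rho>, 0, sqrt (1 - (p4 / p2)^2) * \<rho>),
      (- (p4 / p2) * \<rho>, 0, - sqrt (1 - (p4 / p2)^2) * \<rho>)}"

definition solution_on ::
    "real \<Rightarrow> real \<Rightarrow> real \<Rightarrow> real set \<Rightarrow> (real \<Rightarrow> real \<times> real \<times> real) \<Rightarrow> bool" where
  "solution_on p2 p4 \<rho> T x \<longleftrightarrow>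
     (\<forall>t\<in>T. (x has_vector_derivative vfield p2 p4 \<rho> (x t)) (at t))"

text \<open>The second argument is the parameter \<open>m = k\<^sup>2\<close>, not the modulus \<open>k\<close>. The integral is
  oriented (negative for \<open>\<phi> < 0\<close>). For \<open>0 \<le> m < 1\<close> it is a strictly increasing bijection of the
  reals in \<open>\<phi>\<close>, so the description below is proper; other \<open>m\<close> are not used.\<close>
definition jacobi_am :: "real \<Rightarrow> real \<Rightarrow> real" where
  "jacobi_am u m = (THE \<phi>. u = (LBINT \<theta>=0..ereal \<phi>. 1 / sqrt (1 - m * (sin \<theta>)^2)))"

definition jacobi_sn :: "real \<Rightarrow> real \<Rightarrow> real" where
  "jacobi_sn u m = sin (jacobi_am u m)"

definition jacobi_cn :: "real \<Rightarrow> real \<Rightarrow> real" where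
  "jacobi_cn u m = cos (jacobi_am u m)"

definition jacobi_dn :: "real \<Rightarrow> real \<Rightarrow> real" where
  "jacobi_dn u m = sqrt (1 - m * (sin (jacobi_am u m))^2)"

definition sech :: "real \<Rightarrow> real" where
  "sech x = 1 / cosh x"

end

theory Submission
  imports Defs
begin

text \<open>
  Along solutions of \<open>f' = gh\<close>, \<open>g' = -fh\<close>, \<open>h' = -f\<close> the quantities \<open>f\<^sup>2 + g\<^sup>2\<close> and
  \<open>g - h\<^sup>2/2\<close> are conserved, so \<open>h'\<^sup>2 = (4P\<^sup>2 - h\<^sup>2)(R\<^sub>f\<^sub>g\<^sup>2 - P\<^sup>2 + h\<^sup>2/4)\<close>, the equation of
  a rescaled \<open>cn\<close>, \<open>sech\<close> or \<open>dn\<close>. Each claimed profile, completed by \<open>F = -H'\<close> and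
  \<open>G = (H\<^sup>2 - h\<^sub>0\<^sup>2)/2 + g\<^sub>0\<close>, solves the same system; the conserved quantities make its initial
  value agree with \<open>f\<^sub>0\<close> up to sign, and the phase condition fixes the sign. The
  formulas then follow from uniqueness, which is a Gronwall estimate for the squared distance.
\<close>

subsection \<open>Jacobi elliptic functions\<close>

text \<open>This is the incomplete elliptic integral of the first kind, in terms of the parameter.
  Naming the integral inside \<open>jacobi_am\<close> lets the amplitude be handled as its inverse
  function.\<close>

definition ellipticF :: "real \<Rightarrow> real \<Rightarrow> real" where
  "ellipticF m \<phi> = (LBINT \<theta>=0..ereal \<phi>. 1 / sqrt (1 - m * (sin \<theta>)^2))"

lemma one_minus_m_sin_sq_pos:
  fixes m x :: real
  assumes "0 \<le> m" "m < 1"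
  shows "0 < 1 - m * (sin x)^2"
proof -
  have "m * (sin x)^2 \<le> m * 1"
    using assms by (intro mult_left_mono) (auto simp: abs_square_le_1)
  then show ?thesis using assms by linarith
qed

lemma ellipticF_zero [simp]: "ellipticF m 0 = 0"
  by (simp add: ellipticF_def flip: zero_ereal_def)

lemma DERIV_ellipticF:
  assumes m: "0 \<le> m" "m < 1"
  shows "(ellipticF m has_real_derivative 1 / sqrt (1 - m * (sin x)^2)) (at x)"
proof -
  \<comment> \<open>The margin 1 makes \<open>x\<close> an interior point of an interval that also
    contains the base point 0, so the derivative within the interval is a full derivative.\<close>
  define a b where "a = min 0 x - 1" and "b = max 0 x + 1"
  have ab: "a \<le> 0" "0 \<le> b" "a < x" "x < b" by (auto simp: a_def b_def)
  have ne: "1 - m * (sin \<theta>)^2 \<noteq> 0" for \<theta>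
    using one_minus_m_sin_sq_pos[OF m, of \<theta>] by simp
  have cont: "continuous_on {a..b} (\<lambda>\<theta>. 1 / sqrt (1 - m * (sin \<theta>)^2))"
    by (intro continuous_intros) (use ne in simp)
  have "((\<lambda>u. LBINT \<theta>=ereal 0..ereal u. 1 / sqrt (1 - m * (sin \<theta>)^2))
      has_vector_derivative 1 / sqrt (1 - m * (sin x)^2)) (at x within {a..b})"
    by (rule interval_integral_FTC2[OF ab(1,2) cont]) (use ab in auto)
  moreover have "at x within {a..b} = at x"
    by (rule at_within_interior) (use ab in auto)
  ultimately show ?thesis
    by (simp add: ellipticF_def[abs_def] has_real_derivative_iff_has_vector_derivative
        flip: zero_ereal_def)
qed

lemma isCont_ellipticF:
  assumes "0 \<le> m" "m < 1"
  shows "isCont (ellipticF m) x"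
  using DERIV_ellipticF[OF assms] DERIV_isCont by blast

text \<open>The integrand is at least 1 because \<open>m\<close> is nonnegative. This growth bound
  yields injectivity and, through the intermediate value theorem between -|u| and |u|,
  surjectivity.\<close>

lemma ellipticF_diff_ge:
  assumes m: "0 \<le> m" "m < 1" and "a \<le> b"
  shows "b - a \<le> ellipticF m b - ellipticF m a"
proof -
  have "ellipticF m a - a \<le> ellipticF m b - b"
  proof (rule DERIV_nonneg_imp_nondecreasing[OF \<open>a \<le> b\<close>], intro exI conjI)
    fix x
    show "((\<lambda>x. ellipticF m x - x) has_real_derivative 1 / sqrt (1 - m * (sin x)^2) - 1) (at x)"
      by (intro derivative_intros DERIV_ellipticF m)
    have "sqrt (1 - m * (sin x)^2) \<le> 1" using m by simp
    with one_minus_m_sin_sq_pos[OF m, of x]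
    show "0 \<le> 1 / sqrt (1 - m * (sin x)^2) - 1" by (simp add: field_simps)
  qed
  then show ?thesis by simp
qed

lemma inj_ellipticF:
  assumes "0 \<le> m" "m < 1" "ellipticF m a = ellipticF m b"
  shows "a = b"
  using ellipticF_diff_ge[OF assms(1,2), of a b] ellipticF_diff_ge[OF assms(1,2), of b a] assms(3)
  by linarith

lemma surj_ellipticF:
  assumes m: "0 \<le> m" "m < 1"
  shows "\<exists>\<phi>. ellipticF m \<phi> = u"
proof -
  have "\<exists>\<phi>. -\<bar>u\<bar> \<le> \<phi> \<and> \<phi> \<le> \<bar>u\<bar> \<and> ellipticF m \<phi> = u"
  proof (rule IVT)
    show "ellipticF m (- \<bar>u\<bar>) \<le> u" "u \<le> ellipticF m \<bar>u\<bar>"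
      using ellipticF_diff_ge[OF m, of "-\<bar>u\<bar>" 0] ellipticF_diff_ge[OF m, of 0 "\<bar>u\<bar>"] by auto
  qed (use isCont_ellipticF[OF m] in auto)
  then show ?thesis by blast
qed

text \<open>Injectivity gives the uniqueness required by the definite description in
  \<open>jacobi_am\<close>. Surjectivity then makes this left inverse a two-sided one.\<close>

lemma jacobi_am_ellipticF:
  assumes "0 \<le> m" "m < 1"
  shows "jacobi_am (ellipticF m \<phi>) m = \<phi>"
  unfolding jacobi_am_def ellipticF_def[symmetric]
  by (rule the_equality) (use inj_ellipticF[OF assms] in auto)

lemma ellipticF_jacobi_am:
  assumes "0 \<le> m" "m < 1"
  shows "ellipticF m (jacobi_am u m) = u"
  using surj_ellipticF[OF assms, of u] jacobi_am_ellipticF[OF assms] by auto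

lemma jacobi_dn_pos:
  assumes "0 \<le> m" "m < 1"
  shows "0 < jacobi_dn u m"
  using one_minus_m_sin_sq_pos[OF assms] by (simp add: jacobi_dn_def)

lemma jacobi_sn_cn_sq: "(jacobi_sn u m)^2 + (jacobi_cn u m)^2 = 1"
  by (simp add: jacobi_sn_def jacobi_cn_def)

lemma jacobi_dn_sq:
  assumes "0 \<le> m" "m < 1"
  shows "(jacobi_dn u m)^2 = 1 - m * (jacobi_sn u m)^2"
  using one_minus_m_sin_sq_pos[OF assms, of "jacobi_am u m"] by (simp add: jacobi_dn_def jacobi_sn_def)

text \<open>The inverse function rule gives the reciprocal of the integrand at the amplitude, which
  is dn. Its continuity premise is settled first, from the continuity of \<open>ellipticF\<close>
  and its left inverse.\<close>

lemma DERIV_jacobi_am: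
  assumes m: "0 \<le> m" "m < 1"
  shows "((\<lambda>u. jacobi_am u m) has_real_derivative jacobi_dn u m) (at u)"
proof -
  have "isCont (\<lambda>u. jacobi_am u m) (ellipticF m (jacobi_am u m))"
    by (rule isCont_inverse_function[where d = 1])
      (auto simp: jacobi_am_ellipticF[OF m] isCont_ellipticF[OF m])
  then have cont: "isCont (\<lambda>u. jacobi_am u m) u" by (simp add: ellipticF_jacobi_am[OF m])
  have "((\<lambda>u. jacobi_am u m) has_real_derivative
      inverse (1 / sqrt (1 - m * (sin (jacobi_am u m))^2))) (at u)"
    by (rule DERIV_inverse_function[where f = "ellipticF m" and a = "u - 1" and b = "u + 1"])
      (use DERIV_ellipticF[OF m] cont one_minus_m_sin_sq_pos[OF m, of "jacobi_am u m"]
       in \<open>auto simp: ellipticF_jacobi_am[OF m]\<close>)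
  then show ?thesis by (simp add: jacobi_dn_def)
qed

lemma DERIV_jacobi_sn:
  assumes m: "0 \<le> m" "m < 1"
  shows "((\<lambda>u. jacobi_sn u m) has_real_derivative jacobi_cn u m * jacobi_dn u m) (at u)"
  unfolding jacobi_sn_def jacobi_cn_def
  by (auto intro!: derivative_eq_intros DERIV_jacobi_am[OF m])

lemma DERIV_jacobi_cn:
  assumes m: "0 \<le> m" "m < 1"
  shows "((\<lambda>u. jacobi_cn u m) has_real_derivative - jacobi_sn u m * jacobi_dn u m) (at u)"
  unfolding jacobi_sn_def jacobi_cn_def
  by (auto intro!: derivative_eq_intros DERIV_jacobi_am[OF m])

text \<open>The radicand is positive, so the square root can be differentiated; the factor dn from
  the derivative of sn cancels the one in the denominator.\<close>

lemma DERIV_jacobi_dn: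
  assumes m: "0 \<le> m" "m < 1"
  shows "((\<lambda>u. jacobi_dn u m) has_real_derivative - m * jacobi_sn u m * jacobi_cn u m) (at u)"
proof -
  have eq: "(\<lambda>u. jacobi_dn u m) = (\<lambda>u. sqrt (1 - m * (jacobi_sn u m)^2))"
    by (simp add: fun_eq_iff jacobi_dn_def jacobi_sn_def)
  have pos: "0 < 1 - m * (jacobi_sn u m)^2"
    using one_minus_m_sin_sq_pos[OF m] by (simp add: jacobi_sn_def)
  have dn: "sqrt (1 - m * (jacobi_sn u m)^2) = jacobi_dn u m"
    by (simp add: jacobi_dn_def jacobi_sn_def)
  have "((\<lambda>u. 1 - m * (jacobi_sn u m)^2) has_real_derivative
      - (m * (2 * jacobi_sn u m * (jacobi_cn u m * jacobi_dn u m)))) (at u)"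
    by (rule derivative_eq_intros DERIV_jacobi_sn[OF m] refl)+ (simp add: algebra_simps)
  from DERIV_chain2[OF DERIV_real_sqrt[OF pos] this] show ?thesis
    unfolding eq using jacobi_dn_pos[OF m, of u] by (simp add: dn field_simps)
qed

text \<open>The amplitude is \<open>arccos q\<close>, negated when \<open>s\<close> is negative, and
  \<open>ellipticF\<close> carries it to the argument. The condition on \<open>s\<close> is one of
  compatibility: sn vanishes exactly where |cn| is 1. In the application \<open>s\<close> is the
  initial value of \<open>f\<close>.\<close>

lemma jacobi_cn_phase_exists:
  assumes m: "0 \<le> m" "m < 1" and "\<bar>q\<bar> \<le> 1" and s: "s = 0 \<longleftrightarrow> \<bar>q\<bar> = 1"
  shows "\<exists>u. jacobi_cn u m = q \<and> sgn (jacobi_sn u m) = sgn (s::real)"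
proof -
  define \<phi> where "\<phi> = (if s < 0 then - arccos q else arccos q)"
  have q: "-1 \<le> q" "q \<le> 1" using \<open>\<bar>q\<bar> \<le> 1\<close> by auto
  have c: "cos \<phi> = q" using q by (simp add: \<phi>_def)
  have sq: "sqrt (1 - q^2) = 0 \<longleftrightarrow> \<bar>q\<bar> = 1" "0 \<le> sqrt (1 - q^2)"
    using \<open>\<bar>q\<bar> \<le> 1\<close> by (auto simp: abs_square_le_1 abs_square_eq_1)
  have "sin \<phi> = (if s < 0 then - sqrt (1 - q^2) else sqrt (1 - q^2))"
    using q by (simp add: \<phi>_def sin_arccos)
  then have "sgn (sin \<phi>) = sgn s" using s sq by (auto simp: sgn_if simp del: real_sqrt_eq_0_iff)
  with c show ?thesis
    by (intro exI[of _ "ellipticF m \<phi>"])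
      (simp add: jacobi_cn_def jacobi_sn_def jacobi_am_ellipticF[OF m])
qed

text \<open>Since dn' = -m sn cn, it vanishes exactly where dn is 1 or dn^2 is 1 - m; hence the
  condition on \<open>s\<close>. The sine of the amplitude comes from solving 1 - m r^2 = q^2, and
  the arcsin branch keeps the cosine nonnegative, so the sine alone carries the sign of
  \<open>s\<close>.\<close>

lemma jacobi_dn_phase_exists:
  assumes m: "0 < m" "m < 1" and q: "0 < q" "q \<le> 1" "1 - m \<le> q^2"
    and s: "s = 0 \<longleftrightarrow> q = 1 \<or> q^2 = 1 - m"
  shows "\<exists>u. jacobi_dn u m = q \<and> sgn (deriv (\<lambda>u. jacobi_dn u m) u) = - sgn (s::real)"
proof -
  define r where "r = sqrt ((1 - q^2) / m)"
  have q1: "q^2 \<le> 1" using q by (simp add: abs_square_le_1)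
  have r2: "r^2 = (1 - q^2) / m" using q1 m by (simp add: r_def)
  have r: "0 \<le> r" "r \<le> 1" using m q q1 by (auto simp: r_def)
  define \<phi> where "\<phi> = (if s < 0 then - arcsin r else arcsin r)"
  have sin: "sin \<phi> = (if s < 0 then - r else r)" using r by (simp add: \<phi>_def)
  have cos: "cos \<phi> = sqrt (1 - r^2)" using r by (simp add: \<phi>_def cos_arcsin)
  have dn: "1 - m * (sin \<phi>)^2 = q^2" using m by (simp add: sin r2)
  have r0: "r = 0 \<longleftrightarrow> q = 1"
    using q m by (auto simp: r_def power2_eq_1_iff)
  have r1: "sqrt (1 - r^2) = 0 \<longleftrightarrow> q^2 = 1 - m"
    using m by (auto simp: r2 field_simps)
  have "0 \<le> sqrt (1 - r^2)" using r by (simp add: abs_square_le_1)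
  with r r0 r1 s have sg: "sgn (sin \<phi> * cos \<phi>) = sgn s"
    unfolding sin cos by (auto simp: sgn_if zero_less_mult_iff mult_less_0_iff simp del: real_sqrt_eq_0_iff)
  let ?u = "ellipticF m \<phi>"
  have am: "jacobi_am ?u m = \<phi>" using m by (simp add: jacobi_am_ellipticF)
  have "deriv (\<lambda>u. jacobi_dn u m) ?u = - (m * (sin \<phi> * cos \<phi>))"
    using DERIV_jacobi_dn[of m ?u] m by (simp add: DERIV_imp_deriv jacobi_sn_def jacobi_cn_def am)
  then have "sgn (deriv (\<lambda>u. jacobi_dn u m) ?u) = - sgn s"
    using sg m by (simp add: sgn_mult sgn_minus)
  moreover have "jacobi_dn ?u m = q" using q dn by (simp add: jacobi_dn_def am)
  ultimately show ?thesis by blast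
qed

subsection \<open>The reduced system\<close>

definition fgh_system :: "real set \<Rightarrow> (real \<Rightarrow> real) \<Rightarrow> (real \<Rightarrow> real) \<Rightarrow> (real \<Rightarrow> real) \<Rightarrow> bool" where
  "fgh_system T f g h \<longleftrightarrow>
     (\<forall>t\<in>T. (f has_real_derivative g t * h t) (at t) \<and>
            (g has_real_derivative - (f t * h t)) (at t) \<and>
            (h has_real_derivative - f t) (at t))"

lemma fgh_systemD:
  assumes "fgh_system T f g h" "t \<in> T"
  shows "(f has_real_derivative g t * h t) (at t)"
    and "(g has_real_derivative - (f t * h t)) (at t)"
    and "(h has_real_derivative - f t) (at t)"
  using assms by (auto simp: fgh_system_def)

section \<open>Conservation laws and uniqueness for the reduced system\<close>

lemma DERIV_zero_imp_eq_on_interval: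
  fixes u :: "real \<Rightarrow> real"
  assumes T: "is_interval T" "0 \<in> T" and u: "\<And>t. t \<in> T \<Longrightarrow> (u has_real_derivative 0) (at t)"
    and "t \<in> T"
  shows "u t = u 0"
proof -
  have "\<exists>c. \<forall>x\<in>T. u x = c"
    by (rule has_field_derivative_zero_constant)
      (use T u in \<open>auto simp: is_interval_convex_1 intro: has_field_derivative_at_within\<close>)
  then show ?thesis using T \<open>t \<in> T\<close> by metis
qed

text \<open>To the right of 0 the weight exp(-C t) makes \<open>e\<close> nonincreasing, to the left
  the weight exp(C t) makes it nondecreasing; the weighted functions are nonnegative and vanish at
  0. Bounding the absolute value of \<open>e'\<close> serves both directions.\<close>

lemma gronwall_zero:
  fixes e e' :: "real \<Rightarrow> real"
  assumes T: "is_interval T" "0 \<in> T"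
    and e: "\<And>t. t \<in> T \<Longrightarrow> (e has_real_derivative e' t) (at t)"
    and bound: "\<And>t. t \<in> T \<Longrightarrow> \<bar>e' t\<bar> \<le> C * e t"
    and nonneg: "\<And>t. t \<in> T \<Longrightarrow> 0 \<le> e t" and zero: "e 0 = 0" and t: "t \<in> T"
  shows "e t = 0"
proof (cases "0 \<le> t")
  case True
  have "e t * exp (- C * t) \<le> e 0 * exp (- C * 0)"
  proof (rule DERIV_nonpos_imp_nonincreasing[OF True], intro exI conjI)
    fix x assume "0 \<le> x" "x \<le> t"
    then have x: "x \<in> T" using mem_is_interval_1_I[OF T t] by blast
    show "((\<lambda>x. e x * exp (- C * x)) has_real_derivative (e' x - C * e x) * exp (- C * x)) (at x)"
      by (rule derivative_eq_intros e[OF x] refl)+ (simp add: algebra_simps)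
    show "(e' x - C * e x) * exp (- C * x) \<le> 0"
      using bound[OF x] by (simp add: mult_le_0_iff)
  qed
  then show ?thesis using nonneg[OF t] zero by (simp add: mult_le_0_iff)
next
  case False
  then have "t \<le> 0" by simp
  have "e t * exp (C * t) \<le> e 0 * exp (C * 0)"
  proof (rule DERIV_nonneg_imp_nondecreasing[OF \<open>t \<le> 0\<close>], intro exI conjI)
    fix x assume "t \<le> x" "x \<le> 0"
    then have x: "x \<in> T" using mem_is_interval_1_I[OF T(1) t T(2)] by blast
    show "((\<lambda>x. e x * exp (C * x)) has_real_derivative (e' x + C * e x) * exp (C * x)) (at x)"
      by (rule derivative_eq_intros e[OF x] refl)+ (simp add: algebra_simps)
    show "0 \<le> (e' x + C * e x) * exp (C * x)"
      using bound[OF x] by simp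
  qed
  then show ?thesis using nonneg[OF t] zero by (simp add: mult_le_0_iff)
qed

lemma fgh_conserved_fg:
  assumes T: "is_interval T" "0 \<in> T" and sol: "fgh_system T f g h" and t: "t \<in> T"
  shows "(f t)^2 + (g t)^2 = (f 0)^2 + (g 0)^2"
proof (rule DERIV_zero_imp_eq_on_interval[OF T _ t])
  fix x assume x: "x \<in> T"
  show "((\<lambda>x. (f x)^2 + (g x)^2) has_real_derivative 0) (at x)"
    by (rule derivative_eq_intros fgh_systemD[OF sol x] refl)+ (simp add: algebra_simps)
qed

lemma fgh_conserved_gh:
  assumes T: "is_interval T" "0 \<in> T" and sol: "fgh_system T f g h" and t: "t \<in> T"
  shows "g t = 1/2 * ((h t)^2 - (h 0)^2) + g 0"
proof -
  have "g t - (h t)^2 / 2 = g 0 - (h 0)^2 / 2"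
  proof (rule DERIV_zero_imp_eq_on_interval[OF T _ t])
    fix x assume x: "x \<in> T"
    show "((\<lambda>x. g x - (h x)^2 / 2) has_real_derivative 0) (at x)"
      by (rule derivative_eq_intros fgh_systemD[OF sol x] refl)+ (simp_all add: algebra_simps)
  qed
  then show ?thesis by (simp add: algebra_simps)
qed

text \<open>Conservation of F^2 + G^2 bounds the coefficients that survive in the derivative of the
  squared distance. One Gronwall constant therefore works on all of \<open>T\<close>, without any
  bound on \<open>h\<close> or \<open>H\<close>.\<close>

lemma fgh_unique:
  assumes T: "is_interval T" "0 \<in> T"
    and sol: "fgh_system T f g h" and sol': "fgh_system T F G H"
    and init: "f 0 = F 0" "g 0 = G 0" "h 0 = H 0" and t: "t \<in> T"
  shows "f t = F t \<and> g t = G t \<and> h t = H t"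
proof -
  define A where "A = sqrt ((F 0)^2 + (G 0)^2)"
  have F: "\<bar>F x\<bar> \<le> A" and G: "\<bar>G x\<bar> \<le> A" if "x \<in> T" for x
    using fgh_conserved_fg[OF T sol' that] real_sqrt_sum_squares_ge1[of "\<bar>F x\<bar>" "G x"]
      real_sqrt_sum_squares_ge2[of "\<bar>G x\<bar>" "F x"]
    by (auto simp: A_def)
  define e where "e x = (f x - F x)^2 + (g x - G x)^2 + (h x - H x)^2" for x
  define e' where "e' x = 2 * G x * ((f x - F x) * (h x - H x))
    - 2 * F x * ((g x - G x) * (h x - H x)) - 2 * ((f x - F x) * (h x - H x))" for x
  have prod: "2 * \<bar>a * b\<bar> \<le> a^2 + b^2" for a b :: real
    using sum_squares_bound[of "\<bar>a\<bar>" "\<bar>b\<bar>"] by (simp add: abs_mult mult.assoc)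
  have "e t = 0"
  proof (rule gronwall_zero[OF T _ _ _ _ t])
    fix x assume x: "x \<in> T"
    \<comment> \<open>The terms containing \<open>h\<close> itself cancel, so only the bounded functions \<open>F\<close>, \<open>G\<close> enter.\<close>
    show "(e has_real_derivative e' x) (at x)"
      unfolding e_def[abs_def] e'_def
      by (rule derivative_eq_intros fgh_systemD[OF sol x] fgh_systemD[OF sol' x] refl)+
        (simp add: algebra_simps)
    define a b d where "a = f x - F x" and "b = g x - G x" and "d = h x - H x"
    have "\<bar>e' x\<bar> \<le> \<bar>2 * G x * (a * d)\<bar> + \<bar>2 * F x * (b * d)\<bar> + \<bar>2 * (a * d)\<bar>"
      unfolding e'_def a_def b_def d_def by linarith
    also have "\<dots> = \<bar>G x\<bar> * (2 * \<bar>a * d\<bar>) + \<bar>F x\<bar> * (2 * \<bar>b * d\<bar>) + 2 * \<bar>a * d\<bar>"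
      by (simp add: abs_mult)
    also have "\<dots> \<le> A * (a^2 + d^2) + A * (b^2 + d^2) + (a^2 + d^2)"
      by (intro add_mono mult_mono F G x prod) (use F[OF x] in auto)
    also have "\<dots> \<le> (2 * A + 1) * (a^2 + b^2 + d^2)"
    proof -
      have "0 \<le> A * a^2" "0 \<le> A * b^2" using F[OF x] by auto
      then show ?thesis by (simp add: algebra_simps)
    qed
    finally show "\<bar>e' x\<bar> \<le> (2 * A + 1) * e x" by (simp add: e_def a_def b_def d_def)
  qed (auto simp: e_def init)
  then show ?thesis
    unfolding e_def by (simp add: add_nonneg_eq_0_iff)
qed

text \<open>Defining \<open>G\<close> by the conservation law makes its differential equation
  automatic. For each candidate profile only two derivatives and two initial values are left to
  check.\<close>

lemma fgh_profile_eq: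
  assumes T: "is_interval T" "0 \<in> T" and sol: "fgh_system T f g h"
    and H: "\<And>t. (H has_real_derivative - F t) (at t)"
    and F: "\<And>t. (F has_real_derivative (1/2 * ((H t)^2 - (h 0)^2) + g 0) * H t) (at t)"
    and init: "F 0 = f 0" "H 0 = h 0" and t: "t \<in> T"
  shows "h t = H t"
proof -
  define G where "G t = 1/2 * ((H t)^2 - (h 0)^2) + g 0" for t
  have "(G has_real_derivative - (F t * H t)) (at t)" for t
    unfolding G_def[abs_def] by (rule derivative_eq_intros H refl)+ (simp add: algebra_simps)
  then have sol': "fgh_system T F G H"
    using H F by (auto simp: fgh_system_def G_def)
  have "g 0 = G 0" using init by (simp add: G_def)
  from fgh_unique[OF T sol sol' init(1)[symmetric] this init(2)[symmetric] t]
  show ?thesis by blast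
qed

section \<open>Verification of the cn, dn and sech profiles\<close>

lemma power2_sgn_eq_imp_eq:
  fixes a b :: real
  assumes "a^2 = b^2" "sgn a = sgn b"
  shows "a = b"
proof -
  have "\<bar>a\<bar> = \<bar>b\<bar>" using assms(1) by (auto simp: power2_eq_iff)
  then show ?thesis using assms(2) by (metis sgn_mult_abs)
qed

text \<open>The case condition \<open>lt\<close> is equivalent to P^2 < R^2, that is, m < 1. The
  derivative of sn dn is cn (dn^2 - m sn^2), and R^2 times the last factor is the completed
  \<open>G\<close>; this gives the equation for \<open>F\<close>.\<close>

lemma fgh_cn:
  assumes T: "is_interval T" "0 \<in> T" and sol: "fgh_system T f g h"
    and A: "A^2 = (f 0)^2 + (g 0)^2" and P: "0 < P" "P^2 = (A - g 0) / 2 + (h 0)^2 / 4"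
    and R: "0 < R" "R^2 = A" and lt: "(h 0)^2 < 2 * (A + g 0)" and m: "m = P^2 / R^2"
    and cn: "jacobi_cn t0 m = h 0 / (2 * P)" and sn: "sgn (jacobi_sn t0 m) = sgn (f 0)"
    and t: "t \<in> T"
  shows "h t = 2 * P * jacobi_cn (R * t + t0) m"
proof -
  have h2: "(h 0)^2 = 4 * P^2 - 2 * A + 2 * g 0" unfolding P(2) by (simp add: field_simps)
  have mA: "m * A = P^2" unfolding R(2)[symmetric] m using R(1) by simp
  have "P^2 < R^2" unfolding R(2) P(2) using lt by (simp add: field_simps)
  then have m01: "0 \<le> m" "m < 1" using P(1) R(1) by (simp_all add: m)
  define H where "H t = 2 * P * jacobi_cn (R * t + t0) m" for t
  define F where "F t = 2 * P * R * (jacobi_sn (R * t + t0) m * jacobi_dn (R * t + t0) m)" for t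
  have chain: "((\<lambda>t. u (R * t + t0)) has_real_derivative u' * R) (at t)"
    if "(u has_real_derivative u') (at (R * t + t0))" for u u' t
    by (rule DERIV_chain2[where f = u and g = "\<lambda>t. R * t + t0", OF that]) (auto intro!: derivative_eq_intros)
  note D = chain[OF DERIV_jacobi_sn[OF m01]] chain[OF DERIV_jacobi_cn[OF m01]]
    chain[OF DERIV_jacobi_dn[OF m01]]
  have "h t = H t"
  proof (rule fgh_profile_eq[OF T sol _ _ _ _ t])
    fix t
    define s c d where "s = jacobi_sn (R * t + t0) m" and "c = jacobi_cn (R * t + t0) m"
      and "d = jacobi_dn (R * t + t0) m"
    have s2: "s^2 = 1 - c^2" using jacobi_sn_cn_sq[of "R * t + t0" m] by (simp add: s_def c_def)
    have d2: "d^2 = 1 - m * s^2" using jacobi_dn_sq[OF m01] by (simp add: s_def d_def)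
    show "(H has_real_derivative - F t) (at t)"
      unfolding H_def[abs_def] F_def by (rule derivative_eq_intros D refl)+ (simp add: algebra_simps)
    have "1/2 * ((H t)^2 - (h 0)^2) + g 0 = 2 * P^2 * c^2 + A - 2 * P^2"
      unfolding h2 by (simp add: H_def c_def power_mult_distrib field_simps)
    also have "\<dots> = A * (d^2 - m * s^2)"
      unfolding d2 s2 mA[symmetric] by (simp add: algebra_simps)
    finally have G: "1/2 * ((H t)^2 - (h 0)^2) + g 0 = R^2 * (d^2 - m * s^2)" using R by simp
    show "(F has_real_derivative (1/2 * ((H t)^2 - (h 0)^2) + g 0) * H t) (at t)"
      unfolding G unfolding F_def[abs_def] H_def s_def d_def
      by (rule derivative_eq_intros D refl)+ (simp add: algebra_simps power2_eq_square)
  next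
    show "H 0 = h 0" using P by (simp add: H_def cn)
    have c2: "4 * P^2 * (jacobi_cn t0 m)^2 = (h 0)^2"
      using P(1) by (simp add: cn power_divide power_mult_distrib)
    have s2: "(jacobi_sn t0 m)^2 = 1 - (jacobi_cn t0 m)^2"
      using jacobi_sn_cn_sq[of t0 m] by simp
    have "(F 0)^2 = 4 * P^2 * (jacobi_sn t0 m)^2 * (A * (jacobi_dn t0 m)^2)"
      using R by (simp add: F_def power_mult_distrib)
    also have "\<dots> = (4 * P^2 - 4 * P^2 * (jacobi_cn t0 m)^2) * (A - (m * A) + (m * A) * (jacobi_cn t0 m)^2)"
      unfolding jacobi_dn_sq[OF m01] s2 by (simp add: algebra_simps)
    also have "\<dots> = (4 * P^2 - (h 0)^2) * (A - P^2 + (h 0)^2 / 4)"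
      unfolding mA using c2 by simp
    \<comment> \<open>Unfolding \<open>P\<close> turns the two factors into 2 (A - g 0) and (A + g
      0) / 2, whose product is A^2 - (g 0)^2.\<close>
    also have "\<dots> = (f 0)^2"
      unfolding P(2) using A by (simp add: field_simps power2_eq_square)
    finally have "(F 0)^2 = (f 0)^2" .
    \<comment> \<open>Since dn, \<open>P\<close> and \<open>R\<close> are positive,
      \<open>F 0\<close> has the sign of sn at \<open>t0\<close>, which the phase condition
      prescribes.\<close>
    moreover have "sgn (F 0) = sgn (f 0)"
      using sn P R jacobi_dn_pos[OF m01, of t0] by (simp add: F_def sgn_mult)
    ultimately show "F 0 = f 0" by (rule power2_sgn_eq_imp_eq)
  qed
  then show ?thesis by (simp add: H_def)
qed

text \<open>The roles of \<open>P\<close> and \<open>R\<close> are exchanged: \<open>gt\<close> says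
  R^2 < P^2. The sign \<sigma> of \<open>h 0\<close> occurs both as a factor of \<open>H\<close> and
  in its time argument, so it squares to 1 in \<open>F\<close>; hence the sign of \<open>F 0\<close>
  is opposite to that of dn' at \<open>t0\<close>, whatever the sign of \<open>h 0\<close>.\<close>

lemma fgh_dn:
  assumes T: "is_interval T" "0 \<in> T" and sol: "fgh_system T f g h"
    and A: "A^2 = (f 0)^2 + (g 0)^2" and P: "0 < P" "P^2 = (A - g 0) / 2 + (h 0)^2 / 4"
    and R: "0 < R" "R^2 = A" and gt: "2 * (A + g 0) < (h 0)^2" and m: "m = R^2 / P^2"
    and dn: "jacobi_dn t0 m = \<bar>h 0\<bar> / (2 * P)"
    and dn': "sgn (deriv (\<lambda>u. jacobi_dn u m) t0) = - sgn (f 0)"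
    and t: "t \<in> T"
  shows "h t = sgn (h 0) * 2 * P * jacobi_dn (sgn (h 0) * P * t + t0) m"
proof -
  have h2: "(h 0)^2 = 4 * P^2 - 2 * A + 2 * g 0" unfolding P(2) by (simp add: field_simps)
  have mP: "m * P^2 = A" unfolding R(2)[symmetric] m using P(1) by simp
  have "R^2 < P^2" unfolding R(2) P(2) using gt by (simp add: field_simps)
  then have m01: "0 \<le> m" "0 < m" "m < 1" using P(1) R(1) by (simp_all add: m)
  define \<sigma> where "\<sigma> = sgn (h 0)"
  \<comment> \<open>Since dn is positive, the phase equation itself excludes
    \<open>h 0 = 0\<close>.\<close>
  have "h 0 \<noteq> 0" using dn jacobi_dn_pos[OF m01(1,3), of t0] by auto
  then have \<sigma>2: "\<sigma> * \<sigma> = 1" and \<sigma>h: "\<sigma> * \<bar>h 0\<bar> = h 0" by (auto simp: \<sigma>_def sgn_if)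
  define H where "H t = \<sigma> * 2 * P * jacobi_dn (\<sigma> * P * t + t0) m" for t
  define F where
    "F t = 2 * P^2 * m * (jacobi_sn (\<sigma> * P * t + t0) m * jacobi_cn (\<sigma> * P * t + t0) m)" for t
  have chain: "((\<lambda>t. u (\<sigma> * P * t + t0)) has_real_derivative u' * (\<sigma> * P)) (at t)"
    if "(u has_real_derivative u') (at (\<sigma> * P * t + t0))" for u u' t
    by (rule DERIV_chain2[where f = u and g = "\<lambda>t. \<sigma> * P * t + t0", OF that]) (auto intro!: derivative_eq_intros)
  note D = chain[OF DERIV_jacobi_sn[OF m01(1,3)]] chain[OF DERIV_jacobi_cn[OF m01(1,3)]]
    chain[OF DERIV_jacobi_dn[OF m01(1,3)]]
  have "h t = H t"
  proof (rule fgh_profile_eq[OF T sol _ _ _ _ t])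
    fix t
    define s c d where "s = jacobi_sn (\<sigma> * P * t + t0) m" and "c = jacobi_cn (\<sigma> * P * t + t0) m"
      and "d = jacobi_dn (\<sigma> * P * t + t0) m"
    have c2: "c^2 = 1 - s^2" using jacobi_sn_cn_sq[of "\<sigma> * P * t + t0" m] by (simp add: s_def c_def)
    have d2: "d^2 = 1 - m * s^2" using jacobi_dn_sq[OF m01(1,3)] by (simp add: s_def d_def)
    have "- F t = \<sigma> * \<sigma> * - F t" using \<sigma>2 by simp
    then have F\<sigma>: "- F t = \<sigma> * 2 * P * ((- m * s * c) * (\<sigma> * P))"
      by (simp add: F_def s_def c_def algebra_simps power2_eq_square)
    show "(H has_real_derivative - F t) (at t)"
      unfolding F\<sigma> H_def[abs_def] s_def c_def by (rule derivative_eq_intros D refl)+ simp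
    have "(H t)^2 = (\<sigma> * \<sigma>) * 4 * P^2 * d^2" by (simp add: H_def d_def power2_eq_square)
    then have "1/2 * ((H t)^2 - (h 0)^2) + g 0 = 2 * P^2 * d^2 + m * P^2 - 2 * P^2"
      using mP \<sigma>2 by (simp add: h2 field_simps)
    \<comment> \<open>The difference c^2 - s^2 is the factor produced by the derivative of sn cn,
      which is dn (cn^2 - sn^2).\<close>
    also have "\<dots> = P^2 * m * (c^2 - s^2)"
      unfolding d2 c2 by (simp add: algebra_simps)
    finally have G: "1/2 * ((H t)^2 - (h 0)^2) + g 0 = P^2 * m * (c^2 - s^2)" .
    show "(F has_real_derivative (1/2 * ((H t)^2 - (h 0)^2) + g 0) * H t) (at t)"
      unfolding G unfolding F_def[abs_def] H_def s_def c_def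
      by (rule derivative_eq_intros D refl)+ (simp add: algebra_simps power2_eq_square)
  next
    show "H 0 = h 0" using P \<sigma>h by (simp add: H_def dn)
    have d2: "4 * P^2 * (jacobi_dn t0 m)^2 = (h 0)^2"
      using P(1) by (simp add: dn power_divide power_mult_distrib)
    have ms: "m * (jacobi_sn t0 m)^2 = 1 - (jacobi_dn t0 m)^2"
      using jacobi_dn_sq[OF m01(1,3), of t0] by simp
    have c2: "(jacobi_cn t0 m)^2 = 1 - (jacobi_sn t0 m)^2"
      using jacobi_sn_cn_sq[of t0 m] by simp
    have mc: "m * (jacobi_cn t0 m)^2 = m - 1 + (jacobi_dn t0 m)^2"
      using ms unfolding c2 by (simp add: algebra_simps)
    have "(F 0)^2 = 4 * P^2 * (m * (jacobi_sn t0 m)^2) * (P^2 * (m * (jacobi_cn t0 m)^2))"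
      by (simp add: F_def power_mult_distrib power2_eq_square)
    also have "\<dots> = (4 * P^2 - 4 * P^2 * (jacobi_dn t0 m)^2)
        * (m * P^2 - P^2 + (4 * P^2 * (jacobi_dn t0 m)^2) / 4)"
      unfolding ms mc by (simp add: algebra_simps)
    also have "\<dots> = (4 * P^2 - (h 0)^2) * (A - P^2 + (h 0)^2 / 4)"
      unfolding mP d2 by simp
    also have "\<dots> = (f 0)^2"
      unfolding P(2) using A by (simp add: field_simps power2_eq_square)
    finally have "(F 0)^2 = (f 0)^2" .
    moreover have "F 0 = - (2 * P^2 * deriv (\<lambda>u. jacobi_dn u m) t0)"
      using DERIV_jacobi_dn[OF m01(1,3), of t0] by (simp add: F_def DERIV_imp_deriv)
    then have "sgn (F 0) = sgn (f 0)"
      using dn' P(1) by (simp add: sgn_mult sgn_minus)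
    ultimately show "F 0 = f 0" by (rule power2_sgn_eq_imp_eq)
  qed
  then show ?thesis by (simp add: H_def \<sigma>_def)
qed

text \<open>Here P^2 = A, so the elliptic parameter P^2 / A would be 1, outside the range where the
  Jacobi functions are used; the profile is their hyperbolic limit, and cosh^2 - sinh^2 = 1 replaces
  the elliptic identities.\<close>

lemma fgh_sech:
  assumes T: "is_interval T" "0 \<in> T" and sol: "fgh_system T f g h"
    and A: "A^2 = (f 0)^2 + (g 0)^2" and P: "0 < P" "P^2 = (A - g 0) / 2 + (h 0)^2 / 4"
    and eq: "(h 0)^2 = 2 * (A + g 0)" and h0: "h 0 \<noteq> 0"
    and t0: "t0 = sgn (f 0 * h 0) * arcosh (2 * P / \<bar>h 0\<bar>)"
    and t: "t \<in> T"
  shows "h t = sgn (h 0) * 2 * P * sech (P * t + t0)"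
proof -
  have PA: "P^2 = A" unfolding P(2) eq by (simp add: field_simps)
  have gA: "g 0 \<le> A"
  proof -
    have "0 \<le> A" using PA zero_le_power2[of P] by simp
    moreover have "\<bar>g 0\<bar> \<le> \<bar>A\<bar>" using A by (intro abs_le_square_iff[THEN iffD2]) simp
    ultimately show ?thesis by linarith
  qed
  define \<sigma> where "\<sigma> = sgn (h 0)"
  have \<sigma>2: "\<sigma> * \<sigma> = 1" and \<sigma>h: "\<sigma> * \<bar>h 0\<bar> = h 0" using h0 by (auto simp: \<sigma>_def sgn_if)
  define q where "q = 2 * P / \<bar>h 0\<bar>"
  have hP: "\<bar>h 0\<bar> \<le> 2 * P"
  proof (rule power2_le_imp_le)
    show "\<bar>h 0\<bar>^2 \<le> (2 * P)^2" using PA eq gA by (simp add: power_mult_distrib)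
  qed (use P in simp)
  then have q1: "1 \<le> q" using h0 by (simp add: q_def field_simps)
  \<comment> \<open>If \<open>f 0 = 0\<close>, the sign factor makes \<open>t0\<close> zero. So
    \<open>f 0 = 0\<close> and \<open>q = 1\<close> have to imply each other: one direction serves
    the sign of \<open>sinh t0\<close>, the other \<open>cosh t0 = q\<close>.\<close>
  have f0q: "f 0 = 0" if "q = 1"
  proof -
    have "(2 * P)^2 = \<bar>h 0\<bar>^2" using that h0 by (simp add: q_def field_simps)
    then have "g 0 = A" using PA eq by (simp add: power_mult_distrib)
    then show ?thesis using A by simp
  qed
  have f0q': "q = 1" if "f 0 = 0"
  proof -
    have "g 0 = A \<or> g 0 = - A" using A that by (simp add: power2_eq_iff) auto
    \<comment> \<open>The root -A is excluded because \<open>eq\<close> would then give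
      \<open>h 0 = 0\<close>.\<close>
    moreover have "g 0 \<noteq> - A" using eq h0 by auto
    ultimately have "(2 * P)^2 = \<bar>h 0\<bar>^2" using PA eq by (simp add: power_mult_distrib)
    then have "2 * P = \<bar>h 0\<bar>" by (rule power2_eq_imp_eq) (use P(1) in auto)
    then show ?thesis using h0 by (simp add: q_def)
  qed
  have cosh: "cosh t0 = q"
    using q1 f0q' h0 by (auto simp: t0 sgn_if cosh_arcosh_real simp flip: q_def)
  have sgn_sinh: "sgn (sinh t0) = sgn (f 0 * h 0)"
  proof (cases "f 0 = 0")
    case True then show ?thesis by (simp add: t0)
  next
    case False
    then have "0 < arcosh q" using q1 f0q by auto
    then show ?thesis by (auto simp: t0 sgn_if zero_less_mult_iff simp flip: q_def)
  qed
  define H where "H t = \<sigma> * 2 * P * sech (P * t + t0)" for t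
  define F where "F t = \<sigma> * 2 * P^2 * (sinh (P * t + t0) / (cosh (P * t + t0))^2)" for t
  have ne: "cosh x \<noteq> 0" for x :: real using cosh_real_pos[of x] by simp
  have "h t = H t"
  proof (rule fgh_profile_eq[OF T sol _ _ _ _ t])
    fix t
    show "(H has_real_derivative - F t) (at t)"
      unfolding H_def[abs_def] F_def sech_def
      by (rule derivative_eq_intros refl ne)+ (use ne in \<open>simp add: field_simps power2_eq_square\<close>)
    define s c where "s = sinh (P * t + t0)" and "c = cosh (P * t + t0)"
    have s2: "s^2 = c^2 - 1" by (simp add: s_def c_def sinh_square_eq)
    have c0: "c \<noteq> 0" using ne by (simp add: c_def)
    have "(H t)^2 = (\<sigma> * \<sigma>) * 4 * P^2 / c^2"
      by (simp add: H_def c_def sech_def power2_eq_square)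
    then have G: "1/2 * ((H t)^2 - (h 0)^2) + g 0 = P^2 * (2 / c^2 - 1)"
      using eq PA \<sigma>2 by (simp add: algebra_simps)
    have "(F has_real_derivative \<sigma> * 2 * P^2 * ((c * P * c^2 - s * (2 * c * (s * P))) / (c^2 * c^2))) (at t)"
      unfolding F_def[abs_def] s_def c_def
      by (rule derivative_eq_intros refl ne | simp add: ne)+
    also have "\<sigma> * 2 * P^2 * ((c * P * c^2 - s * (2 * c * (s * P))) / (c^2 * c^2))
        = \<sigma> * 2 * P^2 * (P * c * (c^2 - 2 * s^2) / (c^2 * c^2))"
      by (simp add: algebra_simps power2_eq_square)
    also have "\<dots> = P^2 * (2 / c^2 - 1) * (\<sigma> * 2 * P * (1 / c))"
      unfolding s2 using c0 by (simp add: field_simps power2_eq_square)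
    finally show "(F has_real_derivative (1/2 * ((H t)^2 - (h 0)^2) + g 0) * H t) (at t)"
      unfolding G by (simp add: H_def c_def sech_def)
  next
    show "H 0 = h 0" using P \<sigma>h h0 by (simp add: H_def sech_def cosh q_def)
    have P4: "4 * P^2 / q^2 = (h 0)^2" using P(1) h0 by (simp add: q_def power_divide power_mult_distrib)
    have "(F 0)^2 = (\<sigma> * \<sigma>) * 4 * P^2 * P^2 * ((sinh t0)^2 / (q^2 * q^2))"
      by (simp add: F_def cosh power2_eq_square)
    also have "\<dots> = (4 * P^2 / q^2) * (P^2 - (4 * P^2 / q^2) / 4)"
      unfolding sinh_square_eq cosh \<sigma>2 using q1 by (simp add: field_simps power2_eq_square)
    also have "\<dots> = (f 0)^2"
      unfolding P4 unfolding PA eq using A by (simp add: field_simps power2_eq_square)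
    finally have "(F 0)^2 = (f 0)^2" .
    \<comment> \<open>The sign of \<open>h 0\<close> enters twice, through \<sigma> and through
      \<open>t0\<close>, and cancels, leaving the sign of \<open>f 0\<close>.\<close>
    moreover have "sgn (F 0) = \<sigma> * sgn (f 0 * h 0)"
      using P(1) ne[of t0] by (simp add: F_def sgn_mult sgn_sinh sgn_divide) (simp add: \<sigma>_def)
    then have "sgn (F 0) = sgn (f 0)"
      using \<sigma>2 by (simp add: sgn_mult flip: \<sigma>_def)
    ultimately show "F 0 = f 0" by (rule power2_sgn_eq_imp_eq)
  qed
  then show ?thesis by (simp add: H_def \<sigma>_def)
qed

section \<open>Equilibria, existence of phases and the combined formulas\<close>

lemma fgh_trivial_fh:
  assumes T: "is_interval T" "0 \<in> T" and sol: "fgh_system T f g h"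
    and "f 0 = 0" "h 0 = 0" and t: "t \<in> T"
  shows "f t = 0 \<and> g t = g 0 \<and> h t = 0"
proof -
  have "fgh_system T (\<lambda>_. 0) (\<lambda>_. g 0) (\<lambda>_. 0)" by (simp add: fgh_system_def)
  from fgh_unique[OF T sol this _ _ _ t] show ?thesis using assms by simp
qed

lemma fgh_trivial_fg:
  assumes T: "is_interval T" "0 \<in> T" and sol: "fgh_system T f g h"
    and "f 0 = 0" "g 0 = 0" and t: "t \<in> T"
  shows "f t = 0 \<and> g t = 0 \<and> h t = h 0"
proof -
  have "fgh_system T (\<lambda>_. 0) (\<lambda>_. 0) (\<lambda>_. h 0)" by (simp add: fgh_system_def)
  from fgh_unique[OF T sol this _ _ _ t] show ?thesis using assms by simp
qed

text \<open>From 4 P^2 - h0^2 = 2 (A - g0) comes |h0| \<le> 2 P, with equality exactly when g0 = A.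
  That is equivalent to f0 = 0, because g0 = -A would turn \<open>lt\<close> into h0^2 < 0.\<close>

lemma cn_phase_exists:
  fixes f0 g0 h0 A P R :: real
  assumes A: "A^2 = f0^2 + g0^2" and gA: "\<bar>g0\<bar> \<le> A"
    and P: "0 < P" "P^2 = (A - g0) / 2 + h0^2 / 4"
    and R: "0 < R" "R^2 = A" and lt: "h0^2 < 2 * (A + g0)"
  shows "\<exists>t0. jacobi_cn t0 (P^2 / R^2) = h0 / (2 * P) \<and>
    sgn (jacobi_sn t0 (P^2 / R^2)) = sgn f0"
proof (rule jacobi_cn_phase_exists)
  have "P^2 < A" unfolding P(2) using lt by (simp add: field_simps)
  then show "0 \<le> P^2 / R^2" "P^2 / R^2 < 1" using R by auto
  have le: "h0^2 \<le> (2 * P)^2" using P gA by (simp add: power_mult_distrib)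
  then have "\<bar>h0\<bar> \<le> 2 * P" using P abs_le_square_iff[of h0 "2 * P"] by simp
  then show "\<bar>h0 / (2 * P)\<bar> \<le> 1" using P by (simp add: abs_divide)
  have "\<bar>h0 / (2 * P)\<bar> = 1 \<longleftrightarrow> \<bar>h0\<bar> = \<bar>2 * P\<bar>" using P(1) by (auto simp: abs_divide)
  also have "\<dots> \<longleftrightarrow> h0^2 = (2 * P)^2" by (simp only: power2_eq_iff abs_eq_iff)
  also have "\<dots> \<longleftrightarrow> g0 = A" using P by (auto simp: power_mult_distrib)
  also have "\<dots> \<longleftrightarrow> f0 = 0"
  proof
    assume "f0 = 0"
    then have "g0 = A \<or> g0 = - A" using A by (simp add: power2_eq_iff) auto
    then show "g0 = A" using lt not_less[of "h0^2" 0] by auto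
  qed (use A in simp)
  finally show "f0 = 0 \<longleftrightarrow> \<bar>h0 / (2 * P)\<bar> = 1" by simp
qed

text \<open>After multiplication by P^2 the endpoints of the range of dn become conditions on
  \<open>g0\<close>: q = 1 means g0 = A, and q^2 = 1 - m means g0 = -A. Both can occur in this case,
  and together they amount to f0 = 0.\<close>

lemma dn_phase_exists:
  fixes f0 g0 h0 A P R :: real
  assumes A: "A^2 = f0^2 + g0^2" and gA: "\<bar>g0\<bar> \<le> A"
    and P: "0 < P" "P^2 = (A - g0) / 2 + h0^2 / 4"
    and R: "0 < R" "R^2 = A" and gt: "2 * (A + g0) < h0^2"
  shows "\<exists>t0. jacobi_dn t0 (R^2 / P^2) = \<bar>h0\<bar> / (2 * P) \<and>
    sgn (deriv (\<lambda>u. jacobi_dn u (R^2 / P^2)) t0) = - sgn f0"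
proof (rule jacobi_dn_phase_exists)
  define q where "q = \<bar>h0\<bar> / (2 * P)"
  have P2: "P^2 > 0" using P(1) by simp
  have q2: "4 * P^2 * q^2 = h0^2" using P(1) by (simp add: q_def power_divide power_mult_distrib)
  have q3: "P^2 * q^2 = h0^2 / 4" using q2 by simp
  have m: "R^2 / P^2 * P^2 = A" using R P(1) by simp
  have "A < P^2" unfolding P(2) using gt by (simp add: field_simps)
  then show "0 < R^2 / P^2" "R^2 / P^2 < 1" using P(1) R by auto
  have "0 \<le> 2 * (A + g0)" using gA by (auto simp: abs_le_iff)
  then have "0 < h0^2" using gt by (rule order.strict_trans1)
  then show "0 < \<bar>h0\<bar> / (2 * P)" using P by auto
  then have q0: "0 < q" by (simp add: q_def)
  have "h0^2 \<le> (2 * P)^2" using P gA by (simp add: power_mult_distrib)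
  then have "\<bar>h0\<bar> \<le> 2 * P" using P abs_le_square_iff[of h0 "2 * P"] by simp
  then show "\<bar>h0\<bar> / (2 * P) \<le> 1" using P by simp
  have "P^2 * (1 - R^2 / P^2) = P^2 - A" using m by (simp add: algebra_simps)
  also have "\<dots> \<le> h0^2 / 4"
    unfolding P(2) using gA by (auto simp: field_simps abs_le_iff)
  finally have "P^2 * (1 - R^2 / P^2) \<le> P^2 * q^2" by (simp only: q3)
  then show "1 - R^2 / P^2 \<le> (\<bar>h0\<bar> / (2 * P))^2" using P2 by (simp flip: q_def)
  have "q = 1 \<longleftrightarrow> q^2 = 1" using q0 by (auto simp: power2_eq_1_iff)
  also have "\<dots> \<longleftrightarrow> P^2 * q^2 = P^2" using P2 by simp
  also have "\<dots> \<longleftrightarrow> g0 = A" unfolding q3 unfolding P(2) by (auto simp: field_simps)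
  finally have a: "q = 1 \<longleftrightarrow> g0 = A" .
  have "q^2 = 1 - R^2 / P^2 \<longleftrightarrow> P^2 * q^2 = P^2 * (1 - R^2 / P^2)" using P2 by simp
  also have "\<dots> \<longleftrightarrow> P^2 * q^2 = P^2 - A" using m by (simp add: algebra_simps)
  also have "\<dots> \<longleftrightarrow> g0 = - A" unfolding q3 unfolding P(2) by (auto simp: field_simps)
  finally have b: "q^2 = 1 - R^2 / P^2 \<longleftrightarrow> g0 = - A" .
  have "f0 = 0 \<longleftrightarrow> g0 = A \<or> g0 = - A" using A by (auto simp: power2_eq_iff)
  with a b show "f0 = 0 \<longleftrightarrow> \<bar>h0\<bar> / (2 * P) = 1 \<or> (\<bar>h0\<bar> / (2 * P))^2 = 1 - R^2 / P^2"
    by (simp flip: q_def)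
qed

text \<open>\<open>P\<close> and \<open>R\<close> are the positive roots of the prescribed values.
  Positivity of \<open>A\<close> comes from \<open>fg\<close>; for \<open>P\<close> with
  \<open>h 0 = 0\<close>, the equality A = g 0 would force \<open>f 0 = 0\<close> against
  \<open>fh\<close>. The same argument with A = - g 0 excludes \<open>h 0 = 0\<close> in the
  borderline case.\<close>

lemma fgh_explicit:
  assumes T: "is_interval T" "0 \<in> T" and sol: "fgh_system T f g h"
    and fh: "(f 0, h 0) \<noteq> (0, 0)" and fg: "(f 0, g 0) \<noteq> (0, 0)"
  defines "A \<equiv> sqrt ((f 0)^2 + (g 0)^2)"
  shows "\<exists>P > 0. \<exists>R > 0. P^2 = (A - g 0) / 2 + (h 0)^2 / 4 \<and> R^2 = A \<and>
    ((h 0)^2 < 2 * (A + g 0) \<longrightarrow>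
       (let m = P^2 / R^2;
            phase = (\<lambda>t0. jacobi_cn t0 m = h 0 / (2 * P) \<and> sgn (jacobi_sn t0 m) = sgn (f 0))
        in (\<exists>t0. phase t0) \<and>
           (\<forall>t0. phase t0 \<longrightarrow> (\<forall>t\<in>T. h t = 2 * P * jacobi_cn (R * t + t0) m)))) \<and>
    ((h 0)^2 = 2 * (A + g 0) \<longrightarrow>
       h 0 \<noteq> 0 \<and>
       (let t0 = sgn (f 0 * h 0) * arcosh (2 * P / \<bar>h 0\<bar>)
        in \<forall>t\<in>T. h t = sgn (h 0) * 2 * P * sech (P * t + t0))) \<and>
    ((h 0)^2 > 2 * (A + g 0) \<longrightarrow>
       (let m = R^2 / P^2;
            phase = (\<lambda>t0. jacobi_dn t0 m = \<bar>h 0\<bar> / (2 * P) \<and>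
                          sgn (deriv (\<lambda>u. jacobi_dn u m) t0) = - sgn (f 0))
        in (\<exists>t0. phase t0) \<and>
           (\<forall>t0. phase t0 \<longrightarrow>
              (\<forall>t\<in>T. h t = sgn (h 0) * 2 * P * jacobi_dn (sgn (h 0) * P * t + t0) m))))"
proof -
  have A2: "A^2 = (f 0)^2 + (g 0)^2" by (simp add: A_def)
  have gA: "\<bar>g 0\<bar> \<le> A"
    using real_sqrt_sum_squares_ge2[of "\<bar>g 0\<bar>" "f 0"] by (simp add: A_def)
  have A0: "0 < A"
    using fg unfolding A_def by (auto simp: sum_power2_gt_zero_iff)
  define P where "P = sqrt ((A - g 0) / 2 + (h 0)^2 / 4)"
  define R where "R = sqrt A"
  have R: "0 < R" "R^2 = A" using A0 by (auto simp: R_def)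
  have f0: "f 0 = 0" if "A = g 0" using A2 that by simp
  have "0 < (A - g 0) / 2 + (h 0)^2 / 4"
  proof (cases "h 0 = 0")
    case True
    then have "A \<noteq> g 0" using fh f0 by auto
    then show ?thesis using gA True by simp
  next
    case False
    then have "0 < (h 0)^2" by simp
    then show ?thesis using gA by (intro add_nonneg_pos) auto
  qed
  then have P: "0 < P" "P^2 = (A - g 0) / 2 + (h 0)^2 / 4" by (auto simp: P_def)
  have h0: "h 0 \<noteq> 0" if eq: "(h 0)^2 = 2 * (A + g 0)"
  proof
    assume "h 0 = 0"
    then have "A = - g 0" using eq by simp
    then have "f 0 = 0" using A2 by simp
    then show False using fh \<open>h 0 = 0\<close> by simp
  qed
  show ?thesis
    unfolding Let_def
    by (rule exI[of _ P], rule conjI[OF P(1)], rule exI[of _ R], rule conjI[OF R(1)],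
        rule conjI[OF P(2)], rule conjI[OF R(2)], intro conjI impI)
      (use cn_phase_exists[OF A2 gA P R] fgh_cn[OF T sol A2 P R _ refl]
        h0 fgh_sech[OF T sol A2 P _ _ refl]
        dn_phase_exists[OF A2 gA P R] fgh_dn[OF T sol A2 P R _ refl] in blast)+
qed

subsection \<open>The system on the sphere\<close>

lemma fixed_point_axis:
  assumes "x \<in> axis_points \<rho>"
  shows "fixed_point p2 p4 \<rho> x"
  using assms by (auto simp: axis_points_def fixed_point_def sphere2_def vfield_def)

text \<open>At these points \<open>R\<close> vanishes and p2 D = -p4 \<rho> cancels the second
  component of the field. The bound on \<open>p4\<close> makes the radicand nonnegative, so the
  square root can be squared back in the equation of the sphere.\<close>

lemma fixed_point_side:
  assumes "p2 \<noteq> 0" "0 < p4" "p4 \<le> \<bar>p2\<bar>" and x: "x \<in> side_points p2 p4 \<rho>"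
  shows "fixed_point p2 p4 \<rho> x"
proof -
  have "\<bar>p4 / p2\<bar> \<le> 1" using assms by (simp add: abs_divide)
  then have "(p4 / p2)^2 \<le> 1" by (simp only: abs_square_le_1)
  then have "(sqrt (1 - (p4 / p2)^2))^2 = 1 - (p4 / p2)^2" by simp
  then show ?thesis
    using x \<open>p2 \<noteq> 0\<close>
    by (auto simp: side_points_def fixed_point_def sphere2_def vfield_def power_mult_distrib
        simp del: real_sqrt_pow2_iff) (simp_all add: field_simps)
qed

text \<open>The second equation factors as R' = -2 I (p2 D + p4 \<rho>), which suggests the shifted
  \<open>D\<close> as the unknown \<open>g\<close>; the scalings then absorb all parameters.\<close>

lemma solution_on_imp_fgh_system:
  assumes "solution_on p2 p4 \<rho> T (\<lambda>t. (D t, R t, I t))"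
  shows "fgh_system T (\<lambda>t. 4 * p2 * p4 * \<rho> * R t) (\<lambda>t. 4 * p4 * \<rho> * (p2 * D t + p4 * \<rho>))
    (\<lambda>t. - 2 * p2 * I t)"
  unfolding fgh_system_def
proof
  fix t assume "t \<in> T"
  then have d: "((\<lambda>t. (D t, R t, I t)) has_vector_derivative
      (2 * p2 * I t * R t, - 2 * p2 * I t * D t - 2 * p4 * \<rho> * I t, 2 * p4 * \<rho> * R t)) (at t)"
    using assms by (auto simp: solution_on_def vfield_def)
  \<comment> \<open>Both projection facts stay polymorphic in the second factor, since the state is
    a nested pair and they are applied at two levels.\<close>
  have fst: "((\<lambda>t. fst (x t)) has_vector_derivative fst x') (at t)"
    if "(x has_vector_derivative x') (at t)" for x :: "real \<Rightarrow> real \<times> 'a::real_normed_vector" and x'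
    by (rule bounded_linear.has_vector_derivative[OF bounded_linear_fst that])
  have snd: "((\<lambda>t. snd (x t)) has_vector_derivative snd x') (at t)"
    if "(x has_vector_derivative x') (at t)" for x :: "real \<Rightarrow> real \<times> 'a::real_normed_vector" and x'
    by (rule bounded_linear.has_vector_derivative[OF bounded_linear_snd that])
  have D: "(D has_real_derivative 2 * p2 * I t * R t) (at t)"
    and R: "(R has_real_derivative - 2 * p2 * I t * D t - 2 * p4 * \<rho> * I t) (at t)"
    and I: "(I has_real_derivative 2 * p4 * \<rho> * R t) (at t)"
    using fst[OF d] fst[OF snd[OF d]] snd[OF snd[OF d]]
    by (simp_all add: has_real_derivative_iff_has_vector_derivative)
  show "((\<lambda>t. 4 * p2 * p4 * \<rho> * R t) has_real_derivative
        4 * p4 * \<rho> * (p2 * D t + p4 * \<rho>) * (- 2 * p2 * I t)) (at t) \<and>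
      ((\<lambda>t. 4 * p4 * \<rho> * (p2 * D t + p4 * \<rho>)) has_real_derivative
        - (4 * p2 * p4 * \<rho> * R t * (- 2 * p2 * I t))) (at t) \<and>
      ((\<lambda>t. - 2 * p2 * I t) has_real_derivative - (4 * p2 * p4 * \<rho> * R t)) (at t)"
    by (intro conjI; (rule derivative_eq_intros D R I refl)+; simp add: algebra_simps)
qed

theorem proposition2p14:
  fixes p2 p4 \<rho> :: real
  assumes "p2 \<noteq> 0" and "p4 > 0" and "\<rho> > 0"
  shows
    "(\<forall>x \<in> axis_points \<rho>. fixed_point p2 p4 \<rho> x) \<and>
     (\<bar>p2\<bar> \<ge> p4 \<longrightarrow> (\<forall>x \<in> side_points p2 p4 \<rho>. fixed_point p2 p4 \<rho> x)) \<and>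
     (\<forall>(T :: real set) (D :: real \<Rightarrow> real) (R :: real \<Rightarrow> real) (I :: real \<Rightarrow> real).
        open T \<and> is_interval T \<and> 0 \<in> T \<and>
        solution_on p2 p4 \<rho> T (\<lambda>t. (D t, R t, I t)) \<and>
        (D 0, R 0, I 0) \<in> sphere2 \<rho> \<and>
        (D 0, R 0, I 0) \<notin> axis_points \<rho> \<and>
        \<not> (\<bar>p2\<bar> \<ge> p4 \<and> (D 0, R 0, I 0) \<in> side_points p2 p4 \<rho>) \<longrightarrow>
        (let f = (\<lambda>t. 4 * p2 * p4 * \<rho> * R t);
             g = (\<lambda>t. 4 * p4 * \<rho> * (p2 * D t + p4 * \<rho>));
             h = (\<lambda>t. - 2 * p2 * I t);
             f0 = f 0; g0 = g 0; h0 = h 0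
         in
          (\<forall>t\<in>T. (f has_real_derivative g t * h t) (at t) \<and>
                 (g has_real_derivative - (f t * h t)) (at t) \<and>
                 (h has_real_derivative - f t) (at t)) \<and>
          ((f0, h0) = (0, 0) \<longrightarrow> (\<forall>t\<in>T. (f t, g t, h t) = (0, g0, 0))) \<and>
          ((f0, g0) = (0, 0) \<longrightarrow> (\<forall>t\<in>T. (f t, g t, h t) = (0, 0, h0))) \<and>
          ((f0, h0) \<noteq> (0, 0) \<and> (f0, g0) \<noteq> (0, 0) \<longrightarrow>
            (\<forall>t\<in>T. f t = - deriv h t \<and> g t = 1/2 * ((h t)^2 - h0^2) + g0) \<and>
            (\<exists>P > 0. \<exists>Rfg > 0.
               P^2 = (sqrt (f0^2 + g0^2) - g0) / 2 + h0^2 / 4 \<and>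
               Rfg^2 = sqrt (f0^2 + g0^2) \<and>
               (h0^2 < 2 * (sqrt (f0^2 + g0^2) + g0) \<longrightarrow>
                  (let m = P^2 / Rfg^2;
                       phase = (\<lambda>t0. jacobi_cn t0 m = h0 / (2 * P) \<and>
                                     sgn (jacobi_sn t0 m) = sgn f0)
                   in (\<exists>t0. phase t0) \<and>
                      (\<forall>t0. phase t0 \<longrightarrow>
                         (\<forall>t\<in>T. h t = 2 * P * jacobi_cn (Rfg * t + t0) m)))) \<and>
               (h0^2 = 2 * (sqrt (f0^2 + g0^2) + g0) \<longrightarrow>
                  h0 \<noteq> 0 \<and>
                  (let t0 = sgn (f0 * h0) * arcosh (2 * P / \<bar>h0\<bar>)
                   in \<forall>t\<in>T. h t = sgn h0 * 2 * P * sech (P * t + t0))) \<and>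
               (h0^2 > 2 * (sqrt (f0^2 + g0^2) + g0) \<longrightarrow>
                  (let m = Rfg^2 / P^2;
                       phase = (\<lambda>t0. jacobi_dn t0 m = \<bar>h0\<bar> / (2 * P) \<and>
                                     sgn (deriv (\<lambda>u. jacobi_dn u m) t0) = - sgn f0)
                   in (\<exists>t0. phase t0) \<and>
                      (\<forall>t0. phase t0 \<longrightarrow>
                         (\<forall>t\<in>T. h t = sgn h0 * 2 * P * jacobi_dn (sgn h0 * P * t + t0) m))))))))"
proof (intro conjI ballI impI allI, goal_cases)
  case (1 x)
  then show ?case by (rule fixed_point_axis)
next
  case (2 x)
  with assms show ?case by (intro fixed_point_side)
next
  case (3 T D R I)
  then have T: "is_interval T" "0 \<in> T" and sys: "solution_on p2 p4 \<rho> T (\<lambda>t. (D t, R t, I t))"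
    by auto
  define f where "f = (\<lambda>t. 4 * p2 * p4 * \<rho> * R t)"
  define g where "g = (\<lambda>t. 4 * p4 * \<rho> * (p2 * D t + p4 * \<rho>))"
  define h where "h = (\<lambda>t. - 2 * p2 * I t)"
  have sol: "fgh_system T f g h"
    unfolding f_def g_def h_def by (rule solution_on_imp_fgh_system[OF sys])
  have fg: "f t = - deriv h t \<and> g t = 1/2 * ((h t)^2 - (h 0)^2) + g 0" if "t \<in> T" for t
    using fgh_systemD(3)[OF sol that] fgh_conserved_gh[OF T sol that] by (simp add: DERIV_imp_deriv)
  show ?case
    unfolding f_def[symmetric] g_def[symmetric] h_def[symmetric]
    \<comment> \<open>Only the bindings of the functions and their initial values are opened; those
      of \<open>m\<close>, \<open>phase\<close> and \<open>t0\<close> stay, so that the last goal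
      matches \<open>fgh_explicit\<close>.\<close>
    unfolding Let_def[of f] Let_def[of g] Let_def[of h]
      Let_def[of "f 0"] Let_def[of "g 0"] Let_def[of "h 0"]
  proof (intro conjI impI)
    show "\<forall>t\<in>T. (f has_real_derivative g t * h t) (at t) \<and>
        (g has_real_derivative - (f t * h t)) (at t) \<and> (h has_real_derivative - f t) (at t)"
      using sol by (simp only: fgh_system_def)
    show "\<forall>t\<in>T. (f t, g t, h t) = (0, g 0, 0)" if "(f 0, h 0) = (0, 0)"
      using that fgh_trivial_fh[OF T sol] by simp
    show "\<forall>t\<in>T. (f t, g t, h t) = (0, 0, h 0)" if "(f 0, g 0) = (0, 0)"
      using that fgh_trivial_fg[OF T sol] by simp
    show "\<forall>t\<in>T. f t = - deriv h t \<and> g t = 1/2 * ((h t)^2 - (h 0)^2) + g 0"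
      using fg by simp
  qed (elim conjE, rule fgh_explicit[OF T sol])
qed

end
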